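(* Let $X$ be an $\mathbb{N}$-valued random variable with $\mathrm{range}(X)=\{0,1,\ldots,r\}$ for some positive integer $r$. Then for all partitions $\lambda$ and $\mu$ with $|\lambda|=|\mu|$, $C(\lambda,\mu,X)$ implies $\lambda\trianglerighteq\mu$.
   Context: $\mathbb{N}$ denotes the set of non-negative integers. A partition is a non-increasing function $\lambda:\mathbb{N}\setminus\{0\}\to\mathbb{N}$ with finite support; its weight is $|\lambda|=\sum_i \lambda(i)$. Dominance: $\lambda \trianglerighteq \mu$ iff $|\lambda|=|\mu|$ and $\sum_{i=1}^j \lambda(i) \ge \sum_{i=1}^j \mu(i)$ for all positive integers $j$. $\mathrm{range}(X)=\{n\in\mathbb{N}:P(X=n)\neq0\}$. For a partition $\nu$, let $Y_1,Y_2,\ldots$ be independent random variables, where $Y_i$ is distributed as the sum of $\nu(i)$ independent copies of $X$ (and $Y_i\equiv 0$ if $\nu(i)=0$). For $j,t\in\mathbb{N}$, $E(\nu,X,j,t)$ is the event that $Y_i\le t$ for all $i\ge1$ and $\sum_{i\ge1} Y_i=j$. For partitions $\lambda,\mu$, $C(\lambda,\mu,X)$ is the condition that $P(E(\lambda,X,j,t))\le P(E(\mu,X,j,t))$ for all $j,t\in\mathbb{N}$. *)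

theory Defs
  imports "HOL-Probability.Probability"
begin

text \<open>
  A partition is a function on the positive integers. It is encoded by a function on all of
  \<^typ>\<open>nat\<close> whose value at 0 is never consulted.
\<close>

definition part_support :: "(nat \<Rightarrow> nat) \<Rightarrow> nat set" where
  "part_support \<nu> = {i. 1 \<le> i \<and> \<nu> i \<noteq> 0}"

definition is_partition :: "(nat \<Rightarrow> nat) \<Rightarrow> bool" where
  "is_partition \<nu> \<longleftrightarrow> antimono_on {1..} \<nu> \<and> finite (part_support \<nu>)"

definition weight :: "(nat \<Rightarrow> nat) \<Rightarrow> nat" where
  "weight \<nu> = (\<Sum>i\<in>part_support \<nu>. \<nu> i)"

definition dominates :: "(nat \<Rightarrow> nat) \<Rightarrow> (nat \<Rightarrow> nat) \<Rightarrow> bool" where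
  "dominates \<kappa> \<mu> \<longleftrightarrow>
     weight \<kappa> = weight \<mu> \<and> (\<forall>j\<ge>1. (\<Sum>i=1..j. \<kappa> i) \<ge> (\<Sum>i=1..j. \<mu> i))"

definition rv_range :: "'a measure \<Rightarrow> ('a \<Rightarrow> nat) \<Rightarrow> nat set" where
  "rv_range M X = {n. measure M {\<omega> \<in> space M. X \<omega> = n} \<noteq> 0}"

text \<open>
  Independent copies of \<open>X\<close> are realised on a countable power of the probability space \<open>M\<close>:
  the \<open>k\<close>-th copy used for \<open>Y\<^sub>i\<close> is \<open>X\<close> applied to the coordinate \<open>(i, k)\<close>. Disjoint sets of
  coordinates are used for distinct \<open>i\<close>, so the \<open>Y\<^sub>i\<close> are independent, and \<open>Y\<^sub>i\<close> is the empty sum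
  if \<open>\<nu> i = 0\<close>.
\<close>

definition copies_space :: "'a measure \<Rightarrow> (nat \<times> nat \<Rightarrow> 'a) measure" where
  "copies_space M = PiM UNIV (\<lambda>_. M)"

definition part_rv :: "(nat \<Rightarrow> nat) \<Rightarrow> ('a \<Rightarrow> nat) \<Rightarrow> nat \<Rightarrow> (nat \<times> nat \<Rightarrow> 'a) \<Rightarrow> nat" where
  "part_rv \<nu> X i \<omega> = (\<Sum>k<\<nu> i. X (\<omega> (i, k)))"

text \<open>
  The sum of all \<open>Y\<^sub>i\<close> is taken over the support of \<open>\<nu>\<close>, outside of which \<open>Y\<^sub>i\<close> vanishes.
\<close>

definition part_event ::
  "'a measure \<Rightarrow> (nat \<Rightarrow> nat) \<Rightarrow> ('a \<Rightarrow> nat) \<Rightarrow> nat \<Rightarrow> nat \<Rightarrow> (nat \<times> nat \<Rightarrow> 'a) set" where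
  "part_event M \<nu> X j t =
     {\<omega> \<in> space (copies_space M).
        (\<forall>i\<ge>1. part_rv \<nu> X i \<omega> \<le> t) \<and> (\<Sum>i\<in>part_support \<nu>. part_rv \<nu> X i \<omega>) = j}"

definition part_cond ::
  "'a measure \<Rightarrow> (nat \<Rightarrow> nat) \<Rightarrow> (nat \<Rightarrow> nat) \<Rightarrow> ('a \<Rightarrow> nat) \<Rightarrow> bool" where
  "part_cond M \<kappa> \<mu> X \<longleftrightarrow>
     (\<forall>j t. measure (copies_space M) (part_event M \<kappa> X j t)
          \<le> measure (copies_space M) (part_event M \<mu> X j t))"

end

theory Submission
  imports Defs
begin

text \<open>
  Almost surely every copy of \<open>X\<close> is at most \<open>r\<close>, and each value in \<open>{0..r}\<close> has positive
  probability. Hence the largest \<open>j\<close> for which \<open>E(\<nu>, X, j, r * s)\<close> has positive probability is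
  \<open>r * (\<Sum>i. min s (\<nu> i))\<close>, and the condition forces
  \<open>(\<Sum>i. min s (\<kappa> i)) \<le> (\<Sum>i. min s (\<mu> i))\<close> for all \<open>s\<close>. In terms of conjugate partitions this
  says that the conjugate of \<open>\<mu>\<close> dominates that of \<open>\<kappa>\<close>, which is equivalent to the claim.
\<close>

text \<open>Subtracting the truncated sums from the common weight reverses the hypothesis into an
  inequality between the total excesses of the parts over \<open>s\<close>. The first
  \<open>j\<close> parts of \<open>\<mu>\<close> sum to at most \<open>j * s\<close> plus the total
  excess of \<open>\<mu>\<close>; for \<open>\<kappa>\<close> this bound is attained at a suitable
  \<open>s\<close>. No conjugate partition has to be formed.\<close>

lemma dominates_if_sum_min_le:
  assumes \<kappa>: "is_partition \<kappa>" and \<mu>: "is_partition \<mu>" and w: "weight \<kappa> = weight \<mu>"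
    and le: "\<And>s. (\<Sum>i\<in>part_support \<kappa>. min s (\<kappa> i)) \<le> (\<Sum>i\<in>part_support \<mu>. min s (\<mu> i))"
  shows "dominates \<kappa> \<mu>"
  unfolding dominates_def
proof (intro conjI allI impI w)
  fix j :: nat
  assume j: "j \<ge> 1"
  \<comment> \<open>At this threshold the parts of \<open>\<kappa>\<close> up to index
    \<open>j\<close> are at least \<open>s\<close> and the later ones at most \<open>s\<close>, so
    the whole excess of \<open>\<kappa>\<close> lies in the first \<open>j\<close> parts.\<close>
  define s where "s = \<kappa> j"
  \<comment> \<open>A common finite index set makes sums over the two supports and over
    \<open>{1..j}\<close> comparable.\<close>
  define A where "A = part_support \<kappa> \<union> part_support \<mu> \<union> {1..j}"
  have A: "finite A" "part_support \<kappa> \<subseteq> A" "part_support \<mu> \<subseteq> A" "{1..j} \<subseteq> A"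
    and A_pos: "\<And>i. i \<in> A \<Longrightarrow> i \<ge> 1"
    using \<kappa> \<mu> by (auto simp: A_def is_partition_def part_support_def)
  have to_A: "(\<Sum>i\<in>part_support \<nu>. f (\<nu> i)) = (\<Sum>i\<in>A. f (\<nu> i))"
    if "part_support \<nu> \<subseteq> A" "f 0 = 0" for \<nu> and f :: "nat \<Rightarrow> nat"
    using that A(1) A_pos by (intro sum.mono_neutral_left) (auto simp: part_support_def)
  \<comment> \<open>Subtraction on naturals truncates at 0, so \<open>\<nu> i - s\<close> is exactly
    what \<open>min s\<close> cuts off.\<close>
  have split: "(\<Sum>i\<in>A. \<nu> i - s) + (\<Sum>i\<in>A. min s (\<nu> i)) = (\<Sum>i\<in>A. \<nu> i)" for \<nu> :: "nat \<Rightarrow> nat"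
    unfolding sum.distrib[symmetric] by (intro sum.cong) auto
  have sums: "(\<Sum>i\<in>A. \<kappa> i) = (\<Sum>i\<in>A. \<mu> i)"
    using w to_A[of \<kappa> "\<lambda>x. x"] to_A[of \<mu> "\<lambda>x. x"] A by (simp add: weight_def)
  have "(\<Sum>i\<in>A. min s (\<kappa> i)) \<le> (\<Sum>i\<in>A. min s (\<mu> i))"
    using le[of s] to_A[of \<kappa> "min s"] to_A[of \<mu> "min s"] A by simp
  then have excess: "(\<Sum>i\<in>A. \<mu> i - s) \<le> (\<Sum>i\<in>A. \<kappa> i - s)"
    using split[of \<kappa>] split[of \<mu>] sums by linarith
  have anti: "\<kappa> k \<le> \<kappa> i" if "1 \<le> i" "i \<le> k" for i k
    using \<kappa> that by (auto simp: is_partition_def monotone_on_def)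
  have "(\<Sum>i=1..j. \<mu> i) \<le> (\<Sum>i=1..j. s + (\<mu> i - s))"
    by (intro sum_mono) auto
  also have "\<dots> = j * s + (\<Sum>i=1..j. \<mu> i - s)"
    by (simp add: sum.distrib)
  also have "\<dots> \<le> j * s + (\<Sum>i\<in>A. \<mu> i - s)"
    using A by (intro add_left_mono sum_mono2) auto
  also have "\<dots> \<le> j * s + (\<Sum>i\<in>A. \<kappa> i - s)"
    using excess by simp
  also have "(\<Sum>i\<in>A. \<kappa> i - s) = (\<Sum>i=1..j. \<kappa> i - s)"
    using A A_pos by (intro sum.mono_neutral_right) (use j in \<open>auto simp: s_def not_le intro!: anti\<close>)
  also have "j * s + \<dots> = (\<Sum>i=1..j. s + (\<kappa> i - s))"
    by (simp add: sum.distrib)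
  also have "\<dots> = (\<Sum>i=1..j. \<kappa> i)"
    by (intro sum.cong) (auto simp: s_def anti le_add_diff_inverse)
  finally show "(\<Sum>i=1..j. \<mu> i) \<le> (\<Sum>i=1..j. \<kappa> i)" .
qed

lemma part_event_measurable:
  assumes [measurable]: "X \<in> measurable M (count_space UNIV)"
  shows "part_event M \<nu> X j t \<in> sets (copies_space M)"
  unfolding part_event_def copies_space_def part_rv_def by measurable

text \<open>One configuration of finitely many copies suffices: for each \<open>i\<close>, let
  \<open>min s (\<nu> i)\<close> copies equal \<open>r\<close> and the others 0. Each prescribed
  value has positive probability, and the copies are independent.\<close>

lemma part_event_pos:
  assumes "prob_space M" and X [measurable]: "X \<in> measurable M (count_space UNIV)"
    and range: "rv_range M X = {0..r}" and fin: "finite (part_support \<nu>)"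
  shows "measure (copies_space M)
           (part_event M \<nu> X (r * (\<Sum>i\<in>part_support \<nu>. min s (\<nu> i))) (r * s)) > 0"
proof -
  interpret M: prob_space M by fact
  interpret P: product_prob_space "\<lambda>_ :: nat \<times> nat. M" UNIV
    by unfold_locales
  define x where "x = (\<lambda>(i, k). if k < min s (\<nu> i) then r else (0::nat))"
  define J where "J = Sigma (part_support \<nu>) (\<lambda>i. {..<\<nu> i})"
  define B where "B = (\<lambda>p. {\<omega> \<in> space M. X \<omega> = x p})"
  define D where "D = {\<omega> \<in> space (copies_space M). \<forall>p\<in>J. \<omega> p \<in> B p}"
  have J: "finite J"
    using fin by (auto simp: J_def)
  have B: "B p \<in> sets M" for p
    unfolding B_def by measurable
  have "x p \<in> rv_range M X" for p
    unfolding range by (auto simp: x_def split: prod.splits)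
  then have "measure M (B p) > 0" for p
    by (auto simp: rv_range_def B_def zero_less_measure_iff)
  then have "0 < (\<Prod>p\<in>J. measure M (B p))"
    by (intro prod_pos) auto
  also have "\<dots> = measure (copies_space M) D"
  proof -
    \<comment> \<open>Only the finitely many coordinates in \<open>J\<close> are constrained, so
      \<open>D\<close> is a cylinder and its measure is a finite product.\<close>
    have "D = prod_emb UNIV (\<lambda>_. M) J (Pi\<^sub>E J B)"
      by (auto simp: D_def copies_space_def prod_emb_def space_PiM Pi_iff)
    then show ?thesis
      unfolding copies_space_def using J B by (simp add: P.measure_PiM_emb)
  qed
  also have "\<dots> \<le> measure (copies_space M)
      (part_event M \<nu> X (r * (\<Sum>i\<in>part_support \<nu>. min s (\<nu> i))) (r * s))"
  proof (rule finite_measure.finite_measure_mono)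
    show "finite_measure (copies_space M)"
      unfolding copies_space_def by (rule P.finite_measure_axioms)
    show "D \<subseteq> part_event M \<nu> X (r * (\<Sum>i\<in>part_support \<nu>. min s (\<nu> i))) (r * s)"
    proof
      fix \<omega> assume \<omega>: "\<omega> \<in> D"
      have Y: "part_rv \<nu> X i \<omega> = r * min s (\<nu> i)" if "i \<ge> 1" for i
      proof -
        have "part_rv \<nu> X i \<omega> = (\<Sum>k<\<nu> i. x (i, k))"
          unfolding part_rv_def using \<omega> that
          by (intro sum.cong) (auto simp: D_def J_def B_def part_support_def)
        also have "\<dots> = (\<Sum>k<min s (\<nu> i). r)"
          by (intro sum.mono_neutral_cong_right) (auto simp: x_def)
        finally show ?thesis by simp
      qed
      then have "(\<Sum>i\<in>part_support \<nu>. part_rv \<nu> X i \<omega>) = (\<Sum>i\<in>part_support \<nu>. r * min s (\<nu> i))"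
        by (intro sum.cong) (auto simp: part_support_def)
      then show "\<omega> \<in> part_event M \<nu> X (r * (\<Sum>i\<in>part_support \<nu>. min s (\<nu> i))) (r * s)"
        using \<omega> Y by (auto simp: part_event_def D_def sum_distrib_left)
    qed
  qed (rule part_event_measurable[OF X])
  finally show ?thesis .
qed

text \<open>An event of positive probability contains a sample point at which every copy is at most
  \<open>r\<close>. There each \<open>Y\<^sub>i\<close> is bounded both by
  \<open>r * \<nu> i\<close> and by the cap \<open>r * s\<close>.\<close>

lemma le_if_part_event_pos:
  assumes "prob_space M" and X [measurable]: "X \<in> measurable M (count_space UNIV)"
    and range: "rv_range M X = {0..r}"
    and pos: "measure (copies_space M) (part_event M \<nu> X j (r * s)) > 0"
  shows "j \<le> r * (\<Sum>i\<in>part_support \<nu>. min s (\<nu> i))"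
proof -
  interpret M: prob_space M by fact
  have "AE \<omega> in M. X \<omega> \<noteq> n" if "n > r" for n
  proof (rule AE_I')
    have "measure M {\<omega> \<in> space M. X \<omega> = n} = 0"
      using range that by (metis (mono_tags, lifting) atLeastAtMost_iff mem_Collect_eq not_le rv_range_def)
    then show "{\<omega> \<in> space M. X \<omega> = n} \<in> null_sets M"
      by (simp add: null_sets_def M.emeasure_eq_measure)
  qed auto
  \<comment> \<open>Countably many null sets are discarded together; the same is done below for the
    coordinates \<open>p\<close>.\<close>
  then have "AE \<omega> in M. \<forall>n. n > r \<longrightarrow> X \<omega> \<noteq> n"
    by (auto simp: AE_all_countable)
  then have "AE \<omega> in M. X \<omega> \<le> r"
    by eventually_elim (metis not_le)
  then have "AE \<omega> in copies_space M. X (\<omega> p) \<le> r" for p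
    unfolding copies_space_def by (intro AE_PiM_component) (auto intro: assms(1))
  then have bounded: "AE \<omega> in copies_space M. \<forall>p. X (\<omega> p) \<le> r"
    by (simp add: AE_all_countable)
  have "\<exists>\<omega>. \<omega> \<in> part_event M \<nu> X j (r * s) \<and> (\<forall>p. X (\<omega> p) \<le> r)"
  proof (rule ccontr)
    assume "\<not> ?thesis"
    then have "AE \<omega> in copies_space M. \<omega> \<notin> part_event M \<nu> X j (r * s)"
      by (intro eventually_mono[OF bounded]) auto
    then show False
      using pos measure_eq_0_null_sets[of "part_event M \<nu> X j (r * s)" "copies_space M"]
        AE_iff_null_sets[OF part_event_measurable[OF X]] by auto
  qed
  then obtain \<omega> where \<omega>: "\<omega> \<in> part_event M \<nu> X j (r * s)" "\<And>p. X (\<omega> p) \<le> r"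
    by blast
  have "part_rv \<nu> X i \<omega> \<le> r * min s (\<nu> i)" if "i \<ge> 1" for i
  proof -
    have "part_rv \<nu> X i \<omega> \<le> (\<Sum>k<\<nu> i. r)"
      unfolding part_rv_def by (intro sum_mono \<omega>(2))
    moreover have "part_rv \<nu> X i \<omega> \<le> r * s"
      using \<omega>(1) that by (simp add: part_event_def)
    ultimately show ?thesis by (simp add: min_def mult.commute)
  qed
  then have "(\<Sum>i\<in>part_support \<nu>. part_rv \<nu> X i \<omega>) \<le> (\<Sum>i\<in>part_support \<nu>. r * min s (\<nu> i))"
    by (intro sum_mono) (auto simp: part_support_def)
  then show ?thesis
    using \<omega>(1) by (simp add: part_event_def sum_distrib_left)
qed

theorem theorem6:
  fixes M :: "'a measure" and X :: "'a \<Rightarrow> nat" and r :: nat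
  assumes "prob_space M"
    and "X \<in> measurable M (count_space UNIV)"
    and "r > 0"
    and "rv_range M X = {0..r}"
  shows "\<forall>\<kappa> \<mu>. is_partition \<kappa> \<and> is_partition \<mu> \<and> weight \<kappa> = weight \<mu> \<longrightarrow>
           part_cond M \<kappa> \<mu> X \<longrightarrow> dominates \<kappa> \<mu>"
proof (intro allI impI, elim conjE)
  fix \<kappa> \<mu>
  assume \<kappa>: "is_partition \<kappa>" and \<mu>: "is_partition \<mu>" and w: "weight \<kappa> = weight \<mu>"
    and cond: "part_cond M \<kappa> \<mu> X"
  show "dominates \<kappa> \<mu>"
  proof (rule dominates_if_sum_min_le[OF \<kappa> \<mu> w])
    fix s
    \<comment> \<open>This is the largest total that \<open>\<kappa>\<close> attains with positive
      probability under the cap \<open>r * s\<close>; the condition makes it attainable for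
      \<open>\<mu>\<close> too.\<close>
    let ?j = "r * (\<Sum>i\<in>part_support \<kappa>. min s (\<kappa> i))"
    have "0 < measure (copies_space M) (part_event M \<kappa> X ?j (r * s))"
      using part_event_pos assms(1,2,4) \<kappa> by (auto simp: is_partition_def)
    also have "\<dots> \<le> measure (copies_space M) (part_event M \<mu> X ?j (r * s))"
      using cond by (simp add: part_cond_def)
    finally have "?j \<le> r * (\<Sum>i\<in>part_support \<mu>. min s (\<mu> i))"
      by (rule le_if_part_event_pos[OF assms(1,2,4)])
    then show "(\<Sum>i\<in>part_support \<kappa>. min s (\<kappa> i)) \<le> (\<Sum>i\<in>part_support \<mu>. min s (\<mu> i))"
      using assms(3) by simp
  qed
qed

end
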